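(* Let $\mathcal{X}=\{\mathbf{x}_1,\dots,\mathbf{x}_N\}$ be a finite domain of $N=|\mathcal{X}|$ distinct points, let $k$ be a kernel (covariance function) and $\sigma_n^2>0$ the noise variance of a Gaussian process, and let $J(S)$ be the total posterior variance over $\mathcal{X}$ after sampling at $S\subseteq\mathcal{X}$. Assume that for all $i\neq j$ $$J(\emptyset)-J(\{\mathbf{x}_i,\mathbf{x}_j\}) < \big(J(\emptyset)-J(\{\mathbf{x}_i\})\big)+\big(J(\emptyset)-J(\{\mathbf{x}_j\})\big).$$ Let $K$ be an integer with $2\le K\le N-1$. Put $\alpha_i=J(\{\mathbf{x}_i\})-J(\emptyset)$ for $1\le i\le N$ and $\beta_{i,j}=J(\{\mathbf{x}_i,\mathbf{x}_j\})-J(\{\mathbf{x}_i\})-J(\{\mathbf{x}_j\})+J(\emptyset)$ for $1\le i<j\le N$, and let $B\in\mathbb{R}$ satisfy $$B>\max\Big(2\,\big|\min_{i}\alpha_i\big|\,,\;2K\max_{i<j}\beta_{i,j}\Big).$$ Consider the QUBO objective function $O:\{0,1\}^N\to\mathbb{R}$, $$O(z_1,\dots,z_N)=\sum_{i=1}^{N}\Big(\alpha_i-BK+\frac{B}{2}\Big)z_i+\sum_{1\le i<j\le N}\big(\beta_{i,j}+B\big)z_iz_j .$$ Then every minimizer $(z_1,\dots,z_N)\in\{0,1\}^N$ of $O$ has exactly $K$ coordinates equal to $1$, i.e. $\sum_{i=1}^N z_i=K$.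
   Context: Posterior variance of a Gaussian process: given a symmetric positive semidefinite kernel $k$, a noise variance $\sigma_n^2>0$, and a finite set $S=\{\boldsymbol{\mu}_1,\dots,\boldsymbol{\mu}_m\}$ of sampling locations, the posterior variance at a point $\mathbf{x}$ is $$\sigma^2(\mathbf{x}\mid S)=k(\mathbf{x},\mathbf{x})-\mathbf{k}_*^T(\mathbf{K}+\sigma_n^2\mathbf{I})^{-1}\mathbf{k}_*,$$ where $\mathbf{k}_*=[k(\boldsymbol{\mu}_1,\mathbf{x}),\dots,k(\boldsymbol{\mu}_m,\mathbf{x})]^T$ and $\mathbf{K}=[k(\boldsymbol{\mu}_a,\boldsymbol{\mu}_b)]_{a,b}$; for $S=\emptyset$, $\sigma^2(\mathbf{x}\mid\emptyset)=k(\mathbf{x},\mathbf{x})$. The total posterior variance is $J(S)=\sum_{\mathbf{x}\in\mathcal{X}}\sigma^2(\mathbf{x}\mid S)$. A QUBO (Quadratic Unconstrained Binary Optimization) problem asks to minimize, over binary variables, a function consisting of linear terms plus quadratic terms in pairs of distinct variables. *)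

theory Defs
  imports Complex_Main "Jordan_Normal_Form.Gauss_Jordan_Elimination"
begin

definition psd_kernel_on :: "'a set \<Rightarrow> ('a \<Rightarrow> 'a \<Rightarrow> real) \<Rightarrow> bool" where
  "psd_kernel_on D k \<longleftrightarrow>
     (\<forall>u\<in>D. \<forall>v\<in>D. k u v = k v u) \<and>
     (\<forall>n (p :: nat \<Rightarrow> 'a) (c :: nat \<Rightarrow> real). (\<forall>a<n. p a \<in> D) \<longrightarrow>
        0 \<le> (\<Sum>a<n. \<Sum>b<n. c a * c b * k (p a) (p b)))"

definition gram_mat :: "('a \<Rightarrow> 'a \<Rightarrow> real) \<Rightarrow> 'a list \<Rightarrow> real mat" where
  "gram_mat k \<mu> = mat (length \<mu>) (length \<mu>) (\<lambda>(a, b). k (\<mu> ! a) (\<mu> ! b))"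

definition cross_vec :: "('a \<Rightarrow> 'a \<Rightarrow> real) \<Rightarrow> 'a list \<Rightarrow> 'a \<Rightarrow> real vec" where
  "cross_vec k \<mu> x = vec (length \<mu>) (\<lambda>a. k (\<mu> ! a) x)"

text \<open>The number \<open>v\<close> is the noise variance. The regularised Gram matrix of a positive
  semidefinite kernel is positive definite for \<open>v > 0\<close>, so \<open>mat_inverse\<close> is then not
  \<open>None\<close>.\<close>

definition posterior_var_list ::
    "('a \<Rightarrow> 'a \<Rightarrow> real) \<Rightarrow> real \<Rightarrow> 'a list \<Rightarrow> 'a \<Rightarrow> real" where
  "posterior_var_list k v \<mu> x =
     k x x - cross_vec k \<mu> x \<bullet>
       (the (mat_inverse (gram_mat k \<mu> + v \<cdot>\<^sub>m 1\<^sub>m (length \<mu>))) *\<^sub>v cross_vec k \<mu> x)"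

text \<open>Sampling locations form a set: the matrix formula is evaluated at an enumeration of it
  without repetitions. Reordering conjugates the matrix by a permutation matrix, so the
  value does not depend on the enumeration chosen.\<close>

definition posterior_var ::
    "('a \<Rightarrow> 'a \<Rightarrow> real) \<Rightarrow> real \<Rightarrow> 'a set \<Rightarrow> 'a \<Rightarrow> real" where
  "posterior_var k v S x =
     posterior_var_list k v (SOME \<mu>. distinct \<mu> \<and> set \<mu> = S) x"

lemma posterior_var_empty: "posterior_var k v {} x = k x x"
proof -
  have "(SOME \<mu> :: 'a list. distinct \<mu> \<and> set \<mu> = {}) = []"
    by (rule some_equality) auto
  moreover have A: "gram_mat k [] + v \<cdot>\<^sub>m 1\<^sub>m 0 = (1\<^sub>m 0 :: real mat)"
    by (rule eq_matI) (auto simp: gram_mat_def)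
  moreover have "(1\<^sub>m 0 :: real mat) \<in> Units (ring_mat TYPE(real) 0 ())"
    by (auto simp: Units_def ring_mat_def intro!: bexI[of _ "1\<^sub>m 0"])
  then obtain C where "mat_inverse (1\<^sub>m 0 :: real mat) = Some C"
    using mat_inverse(1)[of "1\<^sub>m 0 :: real mat" 0] by fastforce
  moreover from this have "dim_row C = 0"
    using mat_inverse(2)[of "1\<^sub>m 0 :: real mat" 0 C] by auto
  ultimately show ?thesis
    by (auto simp: posterior_var_def posterior_var_list_def scalar_prod_def)
qed

definition total_posterior_var ::
    "('a \<Rightarrow> 'a \<Rightarrow> real) \<Rightarrow> real \<Rightarrow> 'a set \<Rightarrow> 'a set \<Rightarrow> real" where
  "total_posterior_var k v X S = (\<Sum>x\<in>X. posterior_var k v S x)"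

definition index_pairs :: "nat \<Rightarrow> (nat \<times> nat) set" where
  "index_pairs N = {(i, j). 1 \<le> i \<and> i < j \<and> j \<le> N}"

text \<open>Only the coordinates \<open>1, \<dots>, N\<close> of a point matter; \<open>\<rightarrow>\<^sub>E\<close> fixes the others, so that
  this set has exactly \<open>2 ^ N\<close> elements.\<close>

definition binary_cube :: "nat \<Rightarrow> (nat \<Rightarrow> nat) set" where
  "binary_cube N = {1..N} \<rightarrow>\<^sub>E {0, 1}"

definition qubo_objective ::
    "nat \<Rightarrow> (nat \<Rightarrow> real) \<Rightarrow> (nat \<Rightarrow> nat \<Rightarrow> real) \<Rightarrow> (nat \<Rightarrow> nat) \<Rightarrow> real" where
  "qubo_objective N l q z =
     (\<Sum>i\<in>{1..N}. l i * real (z i)) +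
     (\<Sum>(i, j)\<in>index_pairs N. q i j * real (z i) * real (z j))"

end

theory Submission
  imports Defs
begin

text \<open>With \<open>m = \<Sum> z\<close>, switching a coordinate \<open>i\<close> from \<open>0\<close> to \<open>1\<close> changes the objective by
  \<open>\<alpha> i + \<Sum>j. \<beta> i j * z j + B * (m - K + 1/2)\<close>. Here \<open>\<alpha> i \<le> 0\<close> because sampling does not
  increase the posterior variance, and \<open>\<beta> > 0\<close> by strict submodularity. If \<open>m < K\<close>, fewer than
  \<open>K\<close> of the \<open>\<beta>\<close>-terms occur, so \<open>B > 2 * K * max \<beta>\<close> makes the change negative; if a coordinate
  is switched off while \<open>m > K\<close>, the objective drops because \<open>B > 2 * \<bar>min \<alpha>\<bar>\<close>. So no point with
  \<open>m \<noteq> K\<close> is a minimizer.\<close>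

lemma finite_index_pairs: "finite (index_pairs N)"
  by (rule finite_subset[of _ "{1..N} \<times> {1..N}"]) (auto simp: index_pairs_def)

text \<open>Pairs are stored in increasing order, so a pair through \<open>i\<close> is determined
  by its other member \<open>j\<close>. This turns the part of the quadratic sum touching
  \<open>i\<close> into a sum over \<open>j\<close>.\<close>

lemma index_pairs_containing:
  assumes "i \<in> {1..N}"
  shows "{p \<in> index_pairs N. fst p = i \<or> snd p = i} = (\<lambda>j. (min i j, max i j)) ` ({1..N} - {i})"
proof (intro equalityI subsetI)
  fix p assume p: "p \<in> {p \<in> index_pairs N. fst p = i \<or> snd p = i}"
  show "p \<in> (\<lambda>j. (min i j, max i j)) ` ({1..N} - {i})"
  proof (cases "fst p = i")
    case True
    then show ?thesis
      using p by (intro image_eqI[of _ _ "snd p"]) (auto simp: index_pairs_def)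
  next
    case False
    then show ?thesis
      using p by (intro image_eqI[of _ _ "fst p"]) (auto simp: index_pairs_def)
  qed
next
  fix p assume "p \<in> (\<lambda>j. (min i j, max i j)) ` ({1..N} - {i})"
  then show "p \<in> {p \<in> index_pairs N. fst p = i \<or> snd p = i}"
    using assms by (auto simp: index_pairs_def min_def max_def split: if_splits)
qed

text \<open>Quadratic terms avoiding \<open>i\<close> are the same at both points; those through
  \<open>i\<close> vanish at \<open>z\<close> and lose the factor for \<open>i\<close> after the
  switch.\<close>

lemma qubo_objective_flip:
  assumes i: "i \<in> {1..N}" and z: "z i = 0"
  shows "qubo_objective N l q (z(i := 1)) =
    qubo_objective N l q z + l i + (\<Sum>j\<in>{1..N} - {i}. q (min i j) (max i j) * real (z j))"
proof -
  define P where "P = {p \<in> index_pairs N. fst p = i \<or> snd p = i}"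
  define f where "f w p = q (fst p) (snd p) * real (w (fst p)) * real (w (snd p))"
    for w :: "nat \<Rightarrow> nat" and p
  have P: "P \<subseteq> index_pairs N" by (auto simp: P_def)
  have split: "sum (f w) (index_pairs N) = sum (f w) (index_pairs N - P) + sum (f w) P" for w
    using sum.subset_diff[OF P finite_index_pairs] .
  have image: "sum (f w) P =
      (\<Sum>j\<in>{1..N} - {i}. q (min i j) (max i j) * real (w i) * real (w j))" for w
  proof -
    have inj: "inj_on (\<lambda>j. (min i j, max i j)) ({1..N} - {i})"
      by (auto simp: inj_on_def min_def max_def split: if_splits)
    show ?thesis
      unfolding P_def index_pairs_containing[OF i] sum.reindex[OF inj]
      by (rule sum.cong) (auto simp: f_def min_def max_def)
  qed
  have "sum (f (z(i := 1))) (index_pairs N - P) = sum (f z) (index_pairs N - P)"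
    by (rule sum.cong) (auto simp: f_def P_def)
  moreover have "sum (f (z(i := 1))) P =
      (\<Sum>j\<in>{1..N} - {i}. q (min i j) (max i j) * real (z j))"
    unfolding image by (rule sum.cong) auto
  moreover have "sum (f z) P = 0"
    unfolding image by (simp add: z)
  moreover have "(\<Sum>j\<in>{1..N}. l j * real ((z(i := 1)) j)) = (\<Sum>j\<in>{1..N}. l j * real (z j)) + l i"
    unfolding sum.remove[OF finite_atLeastAtMost i] by (simp add: z)
  moreover have "qubo_objective N l q w = (\<Sum>j\<in>{1..N}. l j * real (w j)) + sum (f w) (index_pairs N)"
    for w
    by (simp add: qubo_objective_def f_def case_prod_unfold)
  ultimately show ?thesis
    by (simp add: split)
qed

lemma psd_kernel_on_diag_nonneg:
  assumes "psd_kernel_on D k" "a \<in> D"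
  shows "0 \<le> k a a"
proof -
  have "0 \<le> (\<Sum>i<n. \<Sum>j<n. c i * c j * k (p i) (p j))"
    if "\<forall>i<n. p i \<in> D" for n :: nat and p and c :: "nat \<Rightarrow> real"
    using assms(1) that unfolding psd_kernel_on_def by blast
  from this[of 1 "\<lambda>_. a" "\<lambda>_. 1"] show ?thesis
    using assms(2) by simp
qed

text \<open>The singleton has only one repetition-free enumeration, and the regularised Gram matrix
  is then 1 by 1, so inverting it means dividing by its positive entry.\<close>

lemma posterior_var_singleton:
  assumes pos: "k a a + v > 0"
  shows "posterior_var k v {a} x = k x x - (k a x)\<^sup>2 / (k a a + v)"
proof -
  have enum: "(SOME \<mu>. distinct \<mu> \<and> set \<mu> = {a}) = [a]"
  proof (rule some_equality)
    fix \<mu> assume \<mu>: "distinct \<mu> \<and> set \<mu> = {a}"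
    then have "length \<mu> = Suc 0"
      using distinct_card[of \<mu>] by simp
    then obtain b where "\<mu> = [b]"
      by (metis length_0_conv length_Suc_conv)
    then show "\<mu> = [a]"
      using \<mu> by simp
  qed simp
  define M where "M = gram_mat k [a] + v \<cdot>\<^sub>m 1\<^sub>m (length [a])"
  have M: "M \<in> carrier_mat 1 1" and M00: "M $$ (0, 0) = k a a + v"
    by (auto simp: M_def gram_mat_def)
  \<comment> \<open>The value of \<open>the (mat_inverse M)\<close> is known only for
    \<open>Some\<close>; the reciprocal of the entry gives an explicit two-sided inverse.\<close>
  have "mat_inverse M \<noteq> None"
  proof
    assume "mat_inverse M = None"
    then have "M \<notin> Units (ring_mat TYPE(real) 1 ())"
      using mat_inverse(1)[OF M, where b = "()"] by blast
    moreover have "mat 1 1 (\<lambda>_. 1 / (k a a + v)) * M = 1\<^sub>m 1"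
      "M * mat 1 1 (\<lambda>_. 1 / (k a a + v)) = 1\<^sub>m 1"
      using M M00 pos by (auto intro!: eq_matI simp: scalar_prod_def)
    ultimately show False
      using M by (auto simp: Units_def ring_mat_def)
  qed
  then obtain C where C: "mat_inverse M = Some C"
    by blast
  then have CM: "M * C = 1\<^sub>m 1" and C1: "C \<in> carrier_mat 1 1"
    using mat_inverse(2)[OF M C] by auto
  have "(M * C) $$ (0, 0) = (k a a + v) * C $$ (0, 0)"
    using M C1 M00 by (simp add: scalar_prod_def)
  then have "(k a a + v) * C $$ (0, 0) = 1"
    by (simp add: CM)
  then have C00: "C $$ (0, 0) = 1 / (k a a + v)"
    using pos by (simp add: field_simps)
  have "cross_vec k [a] x \<bullet> (C *\<^sub>v cross_vec k [a] x) = (k a x)\<^sup>2 / (k a a + v)"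
    using C1 C00 by (simp add: cross_vec_def scalar_prod_def power2_eq_square)
  then show ?thesis
    using C by (simp add: posterior_var_def enum posterior_var_list_def M_def)
qed

text \<open>At each point the variance drops by a square over a positive number. This supplies the
  sign of \<alpha>.\<close>

lemma total_posterior_var_singleton_le:
  assumes "psd_kernel_on D k" "a \<in> D" "v > 0"
  shows "total_posterior_var k v X {a} \<le> total_posterior_var k v X {}"
proof -
  have "k a a + v > 0"
    using psd_kernel_on_diag_nonneg[OF assms(1,2)] assms(3) by simp
  then show ?thesis
    unfolding total_posterior_var_def
    by (intro sum_mono) (simp add: posterior_var_singleton posterior_var_empty)
qed

theorem mainTheorem1:
  fixes x :: "nat \<Rightarrow> 'a"
    and k :: "'a \<Rightarrow> 'a \<Rightarrow> real"
    and noise_var B :: real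
    and N K :: nat
    and J :: "'a set \<Rightarrow> real"
    and \<alpha> :: "nat \<Rightarrow> real"
    and \<beta> :: "nat \<Rightarrow> nat \<Rightarrow> real"
    and z :: "nat \<Rightarrow> nat"
  assumes distinct_points: "inj_on x {1..N}"
    and kernel: "psd_kernel_on (x ` {1..N}) k"
    and noise: "noise_var > 0"
    and J: "\<And>S. S \<subseteq> x ` {1..N} \<Longrightarrow> J S = total_posterior_var k noise_var (x ` {1..N}) S"
    and submodular: "\<And>i j. i \<in> {1..N} \<Longrightarrow> j \<in> {1..N} \<Longrightarrow> i \<noteq> j \<Longrightarrow>
          J {} - J {x i, x j} < (J {} - J {x i}) + (J {} - J {x j})"
    and K: "2 \<le> K" "K \<le> N - 1"
    and \<alpha>: "\<And>i. i \<in> {1..N} \<Longrightarrow> \<alpha> i = J {x i} - J {}"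
    and \<beta>: "\<And>i j. (i, j) \<in> index_pairs N \<Longrightarrow>
          \<beta> i j = J {x i, x j} - J {x i} - J {x j} + J {}"
    and B: "B > max (2 * \<bar>Min (\<alpha> ` {1..N})\<bar>)
                    (2 * real K * Max ((\<lambda>(i, j). \<beta> i j) ` index_pairs N))"
    and minimizer: "is_arg_min
          (qubo_objective N (\<lambda>i. \<alpha> i - B * real K + B / 2) (\<lambda>i j. \<beta> i j + B))
          (\<lambda>w. w \<in> binary_cube N) z"
  shows "card {i \<in> {1..N}. z i = 1} = K \<and> (\<Sum>i\<in>{1..N}. z i) = K"
proof -
  define obj where
    "obj = qubo_objective N (\<lambda>i. \<alpha> i - B * real K + B / 2) (\<lambda>i j. \<beta> i j + B)"
  define m where "m = (\<Sum>i\<in>{1..N}. z i)"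
  \<comment> \<open>The values of \<beta> are prescribed only for increasing indices; sorting the
    arguments extends them symmetrically.\<close>
  define \<gamma> where "\<gamma> i j = \<beta> (min i j) (max i j)" for i j
  have z: "z \<in> binary_cube N" and z_min: "\<And>w. w \<in> binary_cube N \<Longrightarrow> obj z \<le> obj w"
    using minimizer unfolding is_arg_min_def obj_def by (auto simp: not_less)
  have z01: "z i = 0 \<or> z i = 1" if "i \<in> {1..N}" for i
    using z that unfolding binary_cube_def by blast
  have card_eq: "m = card {i \<in> {1..N}. z i = 1}"
  proof -
    have "m = (\<Sum>i\<in>{1..N}. if z i = 1 then 1 else 0)"
      unfolding m_def by (rule sum.cong) (use z01 in auto)
    also have "\<dots> = card {i \<in> {1..N}. z i = 1}"
      by (simp add: sum.If_cases Int_def)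
    finally show ?thesis .
  qed

  have \<alpha>_nonpos: "\<alpha> i \<le> 0" if i: "i \<in> {1..N}" for i
    using total_posterior_var_singleton_le[OF kernel _ noise, of "x i"] i
    by (simp add: \<alpha>[OF i] J)
  have \<alpha>_lower: "- B / 2 < \<alpha> i" if "i \<in> {1..N}" for i
  proof -
    have "Min (\<alpha> ` {1..N}) \<le> \<alpha> i"
      using that by (intro Min_le) auto
    moreover have "2 * \<bar>Min (\<alpha> ` {1..N})\<bar> < B"
      using B by simp
    ultimately show ?thesis
      by linarith
  qed
  have B_pos: "B > 0"
    using B by linarith
  have pair: "(min i j, max i j) \<in> index_pairs N"
    if "i \<in> {1..N}" "j \<in> {1..N} - {i}" for i j
    using that by (auto simp: index_pairs_def min_def max_def)
  have \<gamma>_nonneg: "0 \<le> \<gamma> i j" if "i \<in> {1..N}" "j \<in> {1..N} - {i}" for i j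
  proof -
    let ?a = "min i j" and ?b = "max i j"
    have "?a \<in> {1..N}" "?b \<in> {1..N}" "?a \<noteq> ?b"
      using pair[OF that] by (auto simp: index_pairs_def)
    from submodular[OF this] show ?thesis
      unfolding \<gamma>_def \<beta>[OF pair[OF that]] by simp
  qed
  have \<gamma>_upper: "\<gamma> i j \<le> B / (2 * real K)" if "i \<in> {1..N}" "j \<in> {1..N} - {i}" for i j
  proof -
    have "\<gamma> i j \<le> Max ((\<lambda>(i, j). \<beta> i j) ` index_pairs N)"
      unfolding \<gamma>_def using pair[OF that] finite_index_pairs by (intro Max_ge) force+
    also have "\<dots> \<le> B / (2 * real K)"
      using B K by (simp add: field_simps)
    finally show ?thesis .
  qed

  have flip: "obj (w(i := 1)) = obj w + \<alpha> i + (\<Sum>j\<in>{1..N} - {i}. \<gamma> i j * real (w j))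
      + B * (real (\<Sum>j\<in>{1..N} - {i}. w j) - real K + 1 / 2)"
    if "i \<in> {1..N}" "w i = 0" for i w
    unfolding obj_def qubo_objective_flip[of i N w, OF that]
    by (simp add: \<gamma>_def algebra_simps sum.distrib sum_distrib_left sum_distrib_right)
  have m_remove: "m = z i + (\<Sum>j\<in>{1..N} - {i}. z j)" if "i \<in> {1..N}" for i
    unfolding m_def using that by (intro sum.remove) auto

  have "\<not> m < K"
  proof
    assume "m < K"
    have "\<exists>i\<in>{1..N}. z i = 0"
    proof (rule ccontr)
      assume "\<not> (\<exists>i\<in>{1..N}. z i = 0)"
      then have "m = (\<Sum>i\<in>{1..N}. 1)"
        unfolding m_def using z01 by (intro sum.cong) blast+
      then show False
        using \<open>m < K\<close> K by simp
    qed
    then obtain i where i: "i \<in> {1..N}" "z i = 0"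
      by blast
    have m: "(\<Sum>j\<in>{1..N} - {i}. z j) = m"
      using m_remove[OF i(1)] i(2) by simp
    \<comment> \<open>Only \<open>m\<close> terms are nonzero, each at most
      \<open>B / (2 * K)\<close>, and \<open>m < K\<close> keeps their total below
      \<open>B / 2\<close>.\<close>
    have "(\<Sum>j\<in>{1..N} - {i}. \<gamma> i j * real (z j)) \<le>
        (\<Sum>j\<in>{1..N} - {i}. B / (2 * real K) * real (z j))"
      by (intro sum_mono mult_right_mono \<gamma>_upper i) auto
    also have "\<dots> = B / (2 * real K) * real m"
      by (simp add: m[symmetric] sum_distrib_left)
    also have "\<dots> < B / 2"
      using \<open>m < K\<close> B_pos by (simp add: field_simps)
    finally have "(\<Sum>j\<in>{1..N} - {i}. \<gamma> i j * real (z j)) < B / 2" .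
    \<comment> \<open>Integrality gives \<open>m - K \<le> -1\<close>, so the penalty falls by at
      least \<open>B / 2\<close>, which outweighs the \<gamma>-terms.\<close>
    moreover have "B * (real m - real K + 1 / 2) \<le> B * (- 1 / 2)"
      using \<open>m < K\<close> B_pos by (intro mult_left_mono) auto
    ultimately have "obj (z(i := 1)) < obj z"
      using \<alpha>_nonpos[OF i(1)] unfolding flip[of i z, OF i] m by simp
    moreover have "z(i := 1) \<in> binary_cube N"
      using z i unfolding binary_cube_def by (auto simp: PiE_iff extensional_def)
    ultimately show False
      using z_min by fastforce
  qed
  moreover have "\<not> K < m"
  proof
    assume "K < m"
    have "\<exists>i\<in>{1..N}. z i = 1"
    proof (rule ccontr)
      assume "\<not> (\<exists>i\<in>{1..N}. z i = 1)"
      then have "m = 0"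
        unfolding m_def using z01 by (intro sum.neutral) blast
      then show False
        using \<open>K < m\<close> by simp
    qed
    then obtain i where i: "i \<in> {1..N}" "z i = 1"
      by blast
    \<comment> \<open>Switching off is read as the reverse of switching on from \<open>w\<close>, so
      \<open>flip\<close> applies with \<open>m - 1\<close> other ones.\<close>
    define w where "w = z(i := 0)"
    have w: "w i = 0" and z_eq: "z = w(i := 1)"
      using i by (auto simp: w_def)
    have "(\<Sum>j\<in>{1..N} - {i}. w j) = (\<Sum>j\<in>{1..N} - {i}. z j)"
      by (rule sum.cong) (auto simp: w_def)
    then have m: "real (\<Sum>j\<in>{1..N} - {i}. w j) = real m - 1"
      using m_remove[OF i(1)] i(2) by simp
    have "0 \<le> (\<Sum>j\<in>{1..N} - {i}. \<gamma> i j * real (w j))"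
      by (intro sum_nonneg mult_nonneg_nonneg \<gamma>_nonneg i) auto
    \<comment> \<open>Here \<open>m - 1 - K \<ge> 0\<close>, so the penalty rises by at least
      \<open>B / 2\<close>, more than the decrease that \<alpha> can cause.\<close>
    moreover have "B * (1 / 2) \<le> B * (real m - 1 - real K + 1 / 2)"
      using \<open>K < m\<close> B_pos by (intro mult_left_mono) auto
    ultimately have "obj w < obj (w(i := 1))"
      using \<alpha>_lower[OF i(1)] unfolding flip[of i w, OF i(1) w] m by simp
    moreover have "w \<in> binary_cube N"
      using z i unfolding binary_cube_def w_def by (auto simp: PiE_iff extensional_def)
    ultimately show False
      using z_min z_eq by fastforce
  qed
  ultimately have "m = K"
    by simp
  then show ?thesis
    using card_eq by (simp add: m_def)
qed

end
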